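(* Let $D\geq 1$, let $r_0,r_1\in\mathbb{C}^\times$, let $\rho_-,\rho_+\in\{r_0,r_0^{-1}\}$, and let $c=(c_1,\dots,c_{D-1})$, $s=(s_0,\dots,s_{D-1})$, $\lambda=(\lambda_1,\dots,\lambda_{D-1})$, $\mu=(\mu_0,\dots,\mu_{D-1})$ be tuples of nonzero complex scalars. Assume that $\lambda_1,\dots,\lambda_{D-1}$ are mutually distinct and $\lambda_i\notin\{r_0,r_0^{-1}\}$ for $1\leq i\leq D-1$, and that $\mu_0,\dots,\mu_{D-1}$ are mutually distinct. Then the $\widetilde{\mathcal H}$-module $E_D=E_D(\rho_-,\rho_+;c,s,\lambda,\mu)$ is multiplicity-free and irreducible.
   Context: For nonzero $r_0,r_1\in\mathbb{C}$, $\widetilde{\mathcal H}=\widetilde{\mathcal H}(r_0,r_1)$ is the unital associative $\mathbb{C}$-algebra generated by $t_0,u_0,t_1,u_1$ subject to the relations (i) $(t_i-r_i)(t_i-r_i^{-1})=0$ for $i\in\{0,1\}$; (ii) $u_0^2=u_0$; (iii) $u_1^2=0$; (iv) $u_0t_0t_1u_1=0=t_1u_1u_0t_0$. Set $A=u_0t_0$ and $B=t_1u_1$. For a finite-dimensional $\widetilde{\mathcal H}$-module $V$ and $\alpha,\beta\in\mathbb{C}$ let $V_{\alpha,\beta}=\{v\in V: Av=\alpha v,\ Bv=\beta v\}$. $V$ is multiplicity-free if $A$ and $B$ are diagonalizable on $V$ and every nonzero $V_{\alpha,\beta}$ is one-dimensional. A module is irreducible if it has no nonzero proper submodule. For $c,r,s,\lambda,\mu\in\mathbb{C}^{\times}$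 put $k(r)=r+r^{-1}$ and $$R(r,\lambda,c)=\begin{pmatrix}k(r)-\lambda^{-1}&-c\lambda^{-1}\\ c^{-1}(\lambda-k(r)+\lambda^{-1})&\lambda^{-1}\end{pmatrix},\quad P(c)=\begin{pmatrix}1&c\\0&0\end{pmatrix},$$ $$S(r,s)=\begin{pmatrix}k(r)&s\\-s^{-1}&0\end{pmatrix},\quad N(s,\mu)=\begin{pmatrix}0&0\\ s^{-1}\mu&0\end{pmatrix}.$$ Matrices act on coordinate column vectors. $E_D(\rho_-,\rho_+;c,s,\lambda,\mu)$ is the $2D$-dimensional $\widetilde{\mathcal H}$-module with ordered basis $b_0,a_1,b_1,\dots,a_{D-1},b_{D-1},a_D$ on which $t_0,u_0,t_1,u_1$ are represented respectively by $\operatorname{blockdiag}([\rho_-],R_1,\dots,R_{D-1},[\rho_+])$, $\operatorname{blockdiag}([0],P_1,\dots,P_{D-1},[1])$, $\operatorname{blockdiag}(S_0,\dots,S_{D-1})$, $\operatorname{blockdiag}(N_0,\dots,N_{D-1})$, where $R_i=R(r_0,\lambda_i,c_i)$, $P_i=P(c_i)$ for $1\le i\le D-1$ and $S_i=S(r_1,s_i)$, $N_i=N(s_i,\mu_i)$ for $0\le i\le D-1$. When $D=1$ the tuples $c,\lambda$ are empty and there are no blocks $R_i,P_i$. *)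

theory Defs
  imports
    "HOL-Library.Poly_Mapping"
    "HOL-Algebra.QuotRing"
    "Jordan_Normal_Form.VS_Connect"
begin

text \<open>Words under concatenation form a monoid, written additively because the convolution product
  on finitely supported functions adds the arguments. Hence \<open>gen list \<Rightarrow>\<^sub>0 complex\<close>
  with that product is the free unital associative complex algebra on the letters in \<open>gen\<close>.\<close>

instantiation list :: (type) monoid_add
begin
definition zero_list :: "'a list" where "zero_list = []"
definition plus_list :: "'a list \<Rightarrow> 'a list \<Rightarrow> 'a list" where "plus_list = (@)"
instance by standard (simp_all add: zero_list_def plus_list_def)
end

datatype gen = T0 | U0 | T1 | U1

type_synonym free_alg = "gen list \<Rightarrow>\<^sub>0 complex"

definition letter :: "gen \<Rightarrow> free_alg" where
  "letter g = Poly_Mapping.single [g] 1"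

definition scalar :: "complex \<Rightarrow> free_alg" where
  "scalar a = Poly_Mapping.single [] a"

definition relators :: "complex \<Rightarrow> complex \<Rightarrow> free_alg set" where
  "relators r0 r1 =
    {(letter T0 - scalar r0) * (letter T0 - scalar (inverse r0)),
     (letter T1 - scalar r1) * (letter T1 - scalar (inverse r1)),
     letter U0 ^ 2 - letter U0,
     letter U1 ^ 2,
     letter U0 * letter T0 * letter T1 * letter U1,
     letter T1 * letter U1 * letter U0 * letter T0}"

text \<open>Here \<open>Idl\<close> is the two-sided ideal generated by a set, and \<open>class_ring\<close> is the ring
  structure given by the type class operations.\<close>

definition rel_ideal :: "complex \<Rightarrow> complex \<Rightarrow> free_alg set" where
  "rel_ideal r0 r1 = Idl\<^bsub>(class_ring :: free_alg ring)\<^esub> (relators r0 r1)"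

definition H_alg :: "complex \<Rightarrow> complex \<Rightarrow> free_alg set ring" where
  "H_alg r0 r1 = (class_ring :: free_alg ring) Quot (rel_ideal r0 r1)"

definition H_class :: "complex \<Rightarrow> complex \<Rightarrow> free_alg \<Rightarrow> free_alg set" where
  "H_class r0 r1 p = rel_ideal r0 r1 +>\<^bsub>(class_ring :: free_alg ring)\<^esub> p"

definition H_gen :: "complex \<Rightarrow> complex \<Rightarrow> gen \<Rightarrow> free_alg set" where
  "H_gen r0 r1 g = H_class r0 r1 (letter g)"

definition H_A :: "complex \<Rightarrow> complex \<Rightarrow> free_alg set" where
  "H_A r0 r1 = H_gen r0 r1 U0 \<otimes>\<^bsub>H_alg r0 r1\<^esub> H_gen r0 r1 T0"

definition H_B :: "complex \<Rightarrow> complex \<Rightarrow> free_alg set" where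
  "H_B r0 r1 = H_gen r0 r1 T1 \<otimes>\<^bsub>H_alg r0 r1\<^esub> H_gen r0 r1 U1"

lemma ideal_rel_ideal: "ideal (rel_ideal r0 r1) (class_ring :: free_alg ring)"
  unfolding rel_ideal_def by (rule ring.genideal_ideal[OF class_ring.ring_axioms]) simp

lemma ring_H_alg: "ring (H_alg r0 r1)"
  unfolding H_alg_def by (rule ideal.quotient_is_ring[OF ideal_rel_ideal])

text \<open>A finite-dimensional module with an ordered basis of length \<open>n\<close> is the space of column
  vectors of length \<open>n\<close> together with a homomorphism \<open>\<rho>\<close> of unital complex algebras from the
  algebra to the \<open>n \<times> n\<close> matrices; the element \<open>x\<close> acts by \<open>v \<mapsto> \<rho> x *\<^sub>v v\<close>. The values of
  \<open>\<rho>\<close> outside the carrier of the algebra are irrelevant.\<close>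

definition H_module :: "complex \<Rightarrow> complex \<Rightarrow> nat \<Rightarrow> (free_alg set \<Rightarrow> complex mat) \<Rightarrow> bool" where
  "H_module r0 r1 n \<rho> \<longleftrightarrow>
     \<rho> \<in> Ring.ring_hom (H_alg r0 r1) (ring_mat TYPE(complex) n ()) \<and>
     (\<forall>a. \<rho> (H_class r0 r1 (scalar a)) = a \<cdot>\<^sub>m 1\<^sub>m n)"

definition H_submodule ::
  "complex \<Rightarrow> complex \<Rightarrow> nat \<Rightarrow> (free_alg set \<Rightarrow> complex mat) \<Rightarrow> complex vec set \<Rightarrow> bool" where
  "H_submodule r0 r1 n \<rho> W \<longleftrightarrow>
     VectorSpace.subspace class_ring W (module_vec TYPE(complex) n) \<and>
     (\<forall>x \<in> carrier (H_alg r0 r1). \<forall>w \<in> W. \<rho> x *\<^sub>v w \<in> W)"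

definition H_irreducible ::
  "complex \<Rightarrow> complex \<Rightarrow> nat \<Rightarrow> (free_alg set \<Rightarrow> complex mat) \<Rightarrow> bool" where
  "H_irreducible r0 r1 n \<rho> \<longleftrightarrow>
     \<not> (\<exists>W. H_submodule r0 r1 n \<rho> W \<and> W \<noteq> {0\<^sub>v n} \<and> W \<noteq> carrier_vec n)"

definition diagonalizable :: "complex mat \<Rightarrow> bool" where
  "diagonalizable M \<longleftrightarrow> (\<exists>L. diagonal_mat L \<and> similar_mat M L)"

definition joint_eigenspace ::
  "complex \<Rightarrow> complex \<Rightarrow> nat \<Rightarrow> (free_alg set \<Rightarrow> complex mat) \<Rightarrow> complex \<Rightarrow> complex
    \<Rightarrow> complex vec set" where
  "joint_eigenspace r0 r1 n \<rho> \<alpha> \<beta> =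
     {v \<in> carrier_vec n. \<rho> (H_A r0 r1) *\<^sub>v v = \<alpha> \<cdot>\<^sub>v v \<and> \<rho> (H_B r0 r1) *\<^sub>v v = \<beta> \<cdot>\<^sub>v v}"

definition H_multiplicity_free ::
  "complex \<Rightarrow> complex \<Rightarrow> nat \<Rightarrow> (free_alg set \<Rightarrow> complex mat) \<Rightarrow> bool" where
  "H_multiplicity_free r0 r1 n \<rho> \<longleftrightarrow>
     diagonalizable (\<rho> (H_A r0 r1)) \<and> diagonalizable (\<rho> (H_B r0 r1)) \<and>
     (\<forall>\<alpha> \<beta>. joint_eigenspace r0 r1 n \<rho> \<alpha> \<beta> \<noteq> {0\<^sub>v n} \<longrightarrow>
        vectorspace.dim class_ring
          ((module_vec TYPE(complex) n)\<lparr>carrier := joint_eigenspace r0 r1 n \<rho> \<alpha> \<beta>\<rparr>) = 1)"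

definition kk :: "complex \<Rightarrow> complex" where
  "kk r = r + inverse r"

definition R_block :: "complex \<Rightarrow> complex \<Rightarrow> complex \<Rightarrow> complex mat" where
  "R_block r l c = mat_of_rows_list 2
     [[kk r - inverse l,                          - c * inverse l],
      [inverse c * (l - kk r + inverse l),        inverse l]]"

definition P_block :: "complex \<Rightarrow> complex mat" where
  "P_block c = mat_of_rows_list 2
     [[1, c],
      [0, 0]]"

definition S_block :: "complex \<Rightarrow> complex \<Rightarrow> complex mat" where
  "S_block r s = mat_of_rows_list 2
     [[kk r,         s],
      [- inverse s,  0]]"

definition N_block :: "complex \<Rightarrow> complex \<Rightarrow> complex mat" where
  "N_block s m = mat_of_rows_list 2
     [[0,              0],
      [inverse s * m,  0]]"

definition one_block :: "complex \<Rightarrow> complex mat" where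
  "one_block a = mat_of_rows_list 1 [[a]]"

text \<open>Only the entries \<open>c i, l i\<close> for \<open>1 \<le> i < D\<close> and \<open>s i, m i\<close> for \<open>i < D\<close> of the
  tuples are used.\<close>

definition E_matrix ::
  "nat \<Rightarrow> complex \<Rightarrow> complex \<Rightarrow> complex \<Rightarrow> complex \<Rightarrow>
   (nat \<Rightarrow> complex) \<Rightarrow> (nat \<Rightarrow> complex) \<Rightarrow> (nat \<Rightarrow> complex) \<Rightarrow> (nat \<Rightarrow> complex) \<Rightarrow>
   gen \<Rightarrow> complex mat" where
  "E_matrix D r0 r1 rm rp c s l m g = (case g of
      T0 \<Rightarrow> diag_block_mat ([one_block rm] @ map (\<lambda>i. R_block r0 (l i) (c i)) [1..<D] @ [one_block rp])
    | U0 \<Rightarrow> diag_block_mat ([one_block 0] @ map (\<lambda>i. P_block (c i)) [1..<D] @ [one_block 1])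
    | T1 \<Rightarrow> diag_block_mat (map (\<lambda>i. S_block r1 (s i)) [0..<D])
    | U1 \<Rightarrow> diag_block_mat (map (\<lambda>i. N_block (s i) (m i)) [0..<D]))"

text \<open>\<open>\<rho>\<close> is the module structure of \<open>E\<^sub>D\<close>. As the algebra is generated by the four generators,
  this determines \<open>\<rho>\<close> on the algebra; that such a \<open>\<rho>\<close> exists is not part of the definition.\<close>

definition is_E ::
  "nat \<Rightarrow> complex \<Rightarrow> complex \<Rightarrow> complex \<Rightarrow> complex \<Rightarrow>
   (nat \<Rightarrow> complex) \<Rightarrow> (nat \<Rightarrow> complex) \<Rightarrow> (nat \<Rightarrow> complex) \<Rightarrow> (nat \<Rightarrow> complex) \<Rightarrow>
   (free_alg set \<Rightarrow> complex mat) \<Rightarrow> bool" where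
  "is_E D r0 r1 rm rp c s l m \<rho> \<longleftrightarrow>
     H_module r0 r1 (2 * D) \<rho> \<and>
     (\<forall>g. \<rho> (H_gen r0 r1 g) = E_matrix D r0 r1 rm rp c s l m g)"

end

theory Submission
  imports Defs
begin

text \<open>Everything is read off from the ordered basis \<open>b\<^sub>0, a\<^sub>1, b\<^sub>1, \<dots>, a\<^sub>D\<close>.

  The elements \<open>A = u\<^sub>0 t\<^sub>0\<close> and \<open>B = t\<^sub>1 u\<^sub>1\<close> act diagonally. The matrices of \<open>u\<^sub>0\<close> and \<open>t\<^sub>0\<close> share one
  block pattern and those of \<open>t\<^sub>1\<close> and \<open>u\<^sub>1\<close> another, and the products of corresponding blocks are
  diagonal: \<open>A\<close> multiplies \<open>a\<^sub>i\<close> by \<open>\<lambda>\<^sub>i\<close> for \<open>i < D\<close> and \<open>a\<^sub>D\<close> by \<open>\<rho>\<^sub>+\<close> and kills every \<open>b\<^sub>i\<close>,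
  while \<open>B\<close> multiplies \<open>b\<^sub>i\<close> by \<open>\<mu>\<^sub>i\<close> and kills every \<open>a\<^sub>i\<close> (lemmas \<open>E_U0_mult_T0\<close> and
  \<open>E_T1_mult_U1\<close>). By the hypotheses on the parameters the pairs of eigenvalues are distinct
  (\<open>eigenvalue_pairs_inj\<close>), so the nonzero joint eigenspaces are the coordinate axes. This is
  multiplicity-freeness.

  For irreducibility, the distinct pairs of eigenvalues force a nonzero submodule to contain a basis
  vector. The blocks of \<open>t\<^sub>1\<close> link \<open>b\<^sub>i\<close> with \<open>a\<^bsub>i+1\<^esub>\<close>, and the blocks of \<open>t\<^sub>0\<close> link \<open>a\<^sub>i\<close> with
  \<open>b\<^sub>i\<close>, in both directions; the latter is where \<open>\<lambda>\<^sub>i \<noteq> r\<^sub>0, 1/r\<^sub>0\<close> enters (\<open>E_links\<close>). As the links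
  join all basis vectors into one path, the submodule contains all of them
  (\<open>invariant_subspace_trivial\<close>).

  That the matrices define a module at all is a matter of checking the relations (\<open>E_relations\<close>):
  those on a single generator hold in each block, the ones for \<open>t\<^sub>0\<close> and \<open>t\<^sub>1\<close> by trace and
  determinant, and \<open>A B = 0 = B A\<close> because the diagonals of \<open>A\<close> and \<open>B\<close> have disjoint supports. The
  universal property of the presented algebra (\<open>H_module_of_matrices\<close>) then provides the action.\<close>

section \<open>Modules from matrices that satisfy the relations\<close>

definition word_mat :: "nat \<Rightarrow> (gen \<Rightarrow> complex mat) \<Rightarrow> gen list \<Rightarrow> complex mat" where
  "word_mat n M w = foldr (\<lambda>g X. M g * X) w (1\<^sub>m n)"

text \<open>The linear extension of \<^const>\<open>word_mat\<close>. Matrices of a fixed size do not form a type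
  with an addition and a zero, so the sum is taken entry by entry.\<close>
definition eval_mat :: "nat \<Rightarrow> (gen \<Rightarrow> complex mat) \<Rightarrow> free_alg \<Rightarrow> complex mat" where
  "eval_mat n M p = mat n n (\<lambda>ij. \<Sum>w\<in>Poly_Mapping.keys p. Poly_Mapping.lookup p w * word_mat n M w $$ ij)"

lemma word_mat_carrier:
  assumes "\<forall>g. M g \<in> carrier_mat n n"
  shows "word_mat n M w \<in> carrier_mat n n"
  using assms by (induction w) (auto simp: word_mat_def intro: mult_carrier_mat)

lemma word_mat_append:
  assumes "\<forall>g. M g \<in> carrier_mat n n"
  shows "word_mat n M (v @ w) = word_mat n M v * word_mat n M w"
proof (induction v)
  case Nil
  then show ?case
    using word_mat_carrier[OF assms, of w] by (simp add: word_mat_def)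
next
  case (Cons g v)
  have "word_mat n M ((g # v) @ w) = M g * word_mat n M (v @ w)"
    by (simp add: word_mat_def)
  also have "\<dots> = (M g * word_mat n M v) * word_mat n M w"
    unfolding Cons by (rule assoc_mult_mat[symmetric, of _ n n _ n _ n]) (simp_all add: assms word_mat_carrier)
  finally show ?case by (simp add: word_mat_def)
qed

lemma eval_mat_carrier [simp]: "eval_mat n M p \<in> carrier_mat n n"
  by (simp add: eval_mat_def)

text \<open>The support of a sum or difference depends on cancellation; enlarging the index set makes the
  evaluations of several elements comparable term by term.\<close>
lemma eval_mat_superset:
  assumes "finite S" "Poly_Mapping.keys p \<subseteq> S"
  shows "eval_mat n M p = mat n n (\<lambda>ij. \<Sum>w\<in>S. Poly_Mapping.lookup p w * word_mat n M w $$ ij)"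
  unfolding eval_mat_def
  by (rule cong_mat) (auto intro!: sum.mono_neutral_left assms simp: Poly_Mapping.in_keys_iff)

lemma eval_mat_add: "eval_mat n M (p + q) = eval_mat n M p + eval_mat n M q"
proof -
  let ?S = "Poly_Mapping.keys p \<union> Poly_Mapping.keys q"
  have "Poly_Mapping.keys (p + q) \<subseteq> ?S" by (rule Poly_Mapping.keys_add)
  then show ?thesis
    by (subst (1 2 3) eval_mat_superset[of ?S])
      (auto simp: lookup_add algebra_simps sum.distrib)
qed

lemma eval_mat_single:
  assumes "\<forall>g. M g \<in> carrier_mat n n"
  shows "eval_mat n M (Poly_Mapping.single w a) = a \<cdot>\<^sub>m word_mat n M w"
  using word_mat_carrier[OF assms, of w]
  by (subst eval_mat_superset[of "{w}"]) (auto intro!: eq_matI)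

lemma eval_mat_zero: "eval_mat n M 0 = 0\<^sub>m n n"
  by (auto simp: eval_mat_def)

lemma eval_mat_diff: "eval_mat n M (p - q) = eval_mat n M p - eval_mat n M q"
proof -
  have "eval_mat n M p = eval_mat n M (p - q) + eval_mat n M q"
    by (simp flip: eval_mat_add)
  then show ?thesis
    by (auto intro!: eq_matI simp: eval_mat_def)
qed

text \<open>The step adds a monomial, instead of setting a value outside the support as in
  \<open>Poly_Mapping.update_induct\<close>, so that it can be combined directly with the additivity of a map.\<close>
lemma free_alg_induct [case_names zero add_single]:
  fixes p :: free_alg
  assumes "P 0" and "\<And>p w a. P p \<Longrightarrow> P (p + Poly_Mapping.single w a)"
  shows "P p"
proof (induction p rule: Poly_Mapping.update_induct)
  case const
  show ?case by (rule assms)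
next
  case (update f a b)
  have "Poly_Mapping.update a b f = f + Poly_Mapping.single a b"
    using update(1)
    by (intro poly_mapping_eqI) (auto simp: lookup_update lookup_add lookup_single Poly_Mapping.in_keys_iff when_def)
  then show ?case using assms(2)[OF update(3)] by simp
qed

text \<open>Both sides are additive in \<open>p\<close> and in \<open>q\<close>, so it suffices to compare them on
  monomials, where the claim is that concatenation of words becomes multiplication of matrices.\<close>
lemma eval_mat_mult:
  assumes M: "\<forall>g. M g \<in> carrier_mat n n"
  shows "eval_mat n M (p * q) = eval_mat n M p * eval_mat n M q"
proof (induction p rule: free_alg_induct)
  case zero
  show ?case by (simp add: eval_mat_zero left_mult_zero_mat[OF eval_mat_carrier])
next
  case (add_single p w a)
  have "eval_mat n M (Poly_Mapping.single w a * q) =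
      eval_mat n M (Poly_Mapping.single w a) * eval_mat n M q"
  proof (induction q rule: free_alg_induct)
    case zero
    show ?case by (simp add: eval_mat_zero right_mult_zero_mat[OF eval_mat_carrier])
  next
    case (add_single q v b)
    have "(a \<cdot>\<^sub>m word_mat n M w) * (b \<cdot>\<^sub>m word_mat n M v) =
        (a * b) \<cdot>\<^sub>m (word_mat n M w * word_mat n M v)"
      using word_mat_carrier[OF M, of w] word_mat_carrier[OF M, of v]
      by (intro eq_matI) (auto simp: mult.assoc)
    then have "eval_mat n M (Poly_Mapping.single w a * Poly_Mapping.single v b) =
        eval_mat n M (Poly_Mapping.single w a) * eval_mat n M (Poly_Mapping.single v b)"
      by (simp add: mult_single plus_list_def eval_mat_single[OF M] word_mat_append[OF M])
    with add_single show ?case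
      by (simp add: distrib_left eval_mat_add mult_add_distrib_mat[OF eval_mat_carrier eval_mat_carrier eval_mat_carrier])
  qed
  with add_single show ?case
    by (simp add: distrib_right eval_mat_add add_mult_distrib_mat[OF eval_mat_carrier eval_mat_carrier eval_mat_carrier])
qed

lemma eval_mat_letter:
  assumes "\<forall>g. M g \<in> carrier_mat n n"
  shows "eval_mat n M (letter g) = M g"
  using assms by (auto simp: letter_def eval_mat_single[OF assms] word_mat_def right_mult_one_mat[of _ n n] intro!: eq_matI)

lemma eval_mat_scalar:
  assumes "\<forall>g. M g \<in> carrier_mat n n"
  shows "eval_mat n M (scalar a) = a \<cdot>\<^sub>m 1\<^sub>m n"
  by (simp add: scalar_def eval_mat_single[OF assms] word_mat_def)

lemma H_class_mult:
  "H_class r0 r1 p \<otimes>\<^bsub>H_alg r0 r1\<^esub> H_class r0 r1 q = H_class r0 r1 (p * q)"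
  using ideal.rcoset_mult_add[OF ideal_rel_ideal, of p q r0 r1]
  by (simp add: H_class_def H_alg_def FactRing_def)

lemma H_class_add:
  "H_class r0 r1 p \<oplus>\<^bsub>H_alg r0 r1\<^esub> H_class r0 r1 q = H_class r0 r1 (p + q)"
  using ring_hom_add[OF ideal.rcos_ring_hom[OF ideal_rel_ideal], of p q r0 r1]
  by (simp add: H_class_def H_alg_def)

lemma H_class_one: "\<one>\<^bsub>H_alg r0 r1\<^esub> = H_class r0 r1 1"
  by (simp add: H_class_def H_alg_def FactRing_def)

lemma carrier_H_alg: "carrier (H_alg r0 r1) = range (H_class r0 r1)"
  by (auto simp: H_alg_def H_class_def[abs_def] FactRing_def A_RCOSETS_def')

lemma scalar_one: "scalar 1 = 1"
  by (simp add: scalar_def flip: single_one) (simp add: zero_list_def)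

text \<open>The universal property of the presentation. Evaluation at the four matrices is a homomorphism
  from the free algebra. Its kernel is an ideal that contains the relators, hence the ideal that they
  generate, and so evaluation is constant on the cosets that are the elements of the algebra.\<close>
lemma H_module_of_matrices:
  assumes M: "\<forall>g. M g \<in> carrier_mat n n"
    and t0: "(M T0 - r0 \<cdot>\<^sub>m 1\<^sub>m n) * (M T0 - inverse r0 \<cdot>\<^sub>m 1\<^sub>m n) = 0\<^sub>m n n"
    and t1: "(M T1 - r1 \<cdot>\<^sub>m 1\<^sub>m n) * (M T1 - inverse r1 \<cdot>\<^sub>m 1\<^sub>m n) = 0\<^sub>m n n"
    and u0: "M U0 * M U0 = M U0"
    and u1: "M U1 * M U1 = 0\<^sub>m n n"
    and AB: "(M U0 * M T0) * (M T1 * M U1) = 0\<^sub>m n n"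
    and BA: "(M T1 * M U1) * (M U0 * M T0) = 0\<^sub>m n n"
  shows "\<exists>\<rho>. H_module r0 r1 n \<rho> \<and> (\<forall>g. \<rho> (H_gen r0 r1 g) = M g)"
proof -
  let ?F = "class_ring :: free_alg ring"
  let ?S = "ring_mat TYPE(complex) n ()"
  let ?h = "eval_mat n M"
  have hom: "?h \<in> Ring.ring_hom ?F ?S"
    by (rule ring_hom_memI)
      (simp_all add: ring_mat_simps eval_mat_mult[OF M] eval_mat_add
        flip: scalar_one, simp add: eval_mat_scalar[OF M], auto)
  interpret h: ring_hom_ring ?F ?S ?h
    by (rule ring_hom_ringI2[OF class_ring.ring_axioms ring_mat hom])
  have assoc: "M a * M b * M c * M d = (M a * M b) * (M c * M d)" for a b c d
    by (rule assoc_mult_mat[of _ n n _ n _ n]) (simp_all add: M mult_carrier_mat[of _ n n])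
  note eval = eval_mat_mult[OF M] eval_mat_diff eval_mat_letter[OF M] eval_mat_scalar[OF M]
  have relators: "?h x = 0\<^sub>m n n" if "x \<in> relators r0 r1" for x
    using that t0 t1 u0 u1 AB BA M unfolding relators_def
    by (auto simp: eval power2_eq_square assoc)
  have kernel: "a_kernel ?F ?S ?h = {p. ?h p = 0\<^sub>m n n}"
    unfolding a_kernel_def' by (simp add: ring_mat_simps)
  have "rel_ideal r0 r1 \<subseteq> {p. ?h p = 0\<^sub>m n n}"
    unfolding rel_ideal_def
  proof (rule ring.genideal_minimal[OF class_ring.ring_axioms])
    show "ideal {p. ?h p = 0\<^sub>m n n} ?F"
      using h.kernel_is_ideal by (simp only: kernel)
    show "relators r0 r1 \<subseteq> {p. ?h p = 0\<^sub>m n n}"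
      using relators by blast
  qed
  then have ker: "?h k = 0\<^sub>m n n" if "k \<in> rel_ideal r0 r1" for k
    using that by blast
  have zero_mem: "0 \<in> rel_ideal r0 r1"
    using additive_subgroup.zero_closed[OF ideal.axioms(1)[OF ideal_rel_ideal]] by simp
  define \<rho> where "\<rho> X = the_elem (?h ` X)" for X
  have \<rho>: "\<rho> (H_class r0 r1 p) = ?h p" for p
  proof -
    have "?h ` H_class r0 r1 p = {?h p}"
      using ker zero_mem
      by (force simp: H_class_def a_r_coset_def' eval_mat_add left_add_zero_mat[OF eval_mat_carrier])
    then show ?thesis by (simp add: \<rho>_def)
  qed
  have "\<rho> \<in> Ring.ring_hom (H_alg r0 r1) ?S"
  proof (rule ring_hom_memI)
    show "\<rho> \<one>\<^bsub>H_alg r0 r1\<^esub> = \<one>\<^bsub>?S\<^esub>"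
      using h.hom_one by (simp add: H_class_one \<rho>)
  qed (auto simp: carrier_H_alg \<rho> ring_mat_simps H_class_mult H_class_add eval_mat_add eval_mat_mult[OF M])
  then show ?thesis
    by (intro exI[of _ \<rho>]) (auto simp: H_module_def \<rho> H_gen_def eval_mat_scalar[OF M] eval_mat_letter[OF M])
qed

lemma H_module_H_A_H_B:
  assumes "H_module r0 r1 n \<rho>"
  shows "\<rho> (H_A r0 r1) = \<rho> (H_gen r0 r1 U0) * \<rho> (H_gen r0 r1 T0)"
    and "\<rho> (H_B r0 r1) = \<rho> (H_gen r0 r1 T1) * \<rho> (H_gen r0 r1 U1)"
  using assms unfolding H_module_def H_A_def H_B_def
  by (auto dest!: ring_hom_mult simp: ring_mat_simps H_gen_def carrier_H_alg)

section \<open>Separating families of diagonal operators\<close>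

lemma mult_mat_diag_vec_index:
  assumes "v \<in> carrier_vec n" "i < n"
  shows "(mat_diag n f *\<^sub>v v) $ i = (f i * v $ i :: 'a :: semiring_0)"
proof -
  have "(mat_diag n f *\<^sub>v v) $ i = (\<Sum>j\<in>{0..<n}. (if i = j then f j else 0) * v $ j)"
    using assms by (simp add: mat_diag_def scalar_prod_def)
  also have "\<dots> = (\<Sum>j\<in>{0..<n}. if i = j then f j * v $ j else 0)"
    by (rule sum.cong) auto
  finally show ?thesis using assms by simp
qed

lemma subspace_vecD:
  assumes "VectorSpace.subspace (class_ring :: 'a :: field ring) W (module_vec TYPE('a) n)"
  shows "W \<subseteq> carrier_vec n" "0\<^sub>v n \<in> W"
    and "\<And>v w. v \<in> W \<Longrightarrow> w \<in> W \<Longrightarrow> v + w \<in> W" "\<And>a v. v \<in> W \<Longrightarrow> a \<cdot>\<^sub>v v \<in> W"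
proof -
  interpret submodule "class_ring :: 'a ring" W "module_vec TYPE('a) n"
    using assms by (simp add: VectorSpace.subspace_def)
  show "W \<subseteq> carrier_vec n" "0\<^sub>v n \<in> W"
    and "\<And>v w. v \<in> W \<Longrightarrow> w \<in> W \<Longrightarrow> v + w \<in> W" "\<And>a v. v \<in> W \<Longrightarrow> a \<cdot>\<^sub>v v \<in> W"
    using subset zero_closed m_closed smult_closed by (auto simp: module_vec_simps)
qed

text \<open>Suppose \<open>w\<close> has nonzero entries at \<open>i\<close> and at some other \<open>j\<close>, and let \<open>f\<close> be a member of
  the family with \<open>f j \<noteq> f i\<close>. The vector obtained from \<open>w\<close> by the diagonal
  operator of \<open>f\<close> minus \<open>f j\<close> has lost the entry at \<open>j\<close>, has kept a nonzero entry at \<open>i\<close>,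
  and has no new nonzero entries. Repeating this leaves a nonzero multiple of the \<open>i\<close>-th unit vector.\<close>
lemma unit_vec_mem_of_separating_diagonals:
  fixes W :: "'a :: field vec set"
  assumes sub: "VectorSpace.subspace class_ring W (module_vec TYPE('a) n)"
    and inv: "\<And>f w. f \<in> F \<Longrightarrow> w \<in> W \<Longrightarrow> mat_diag n f *\<^sub>v w \<in> W"
    and sep: "\<And>j. j < n \<Longrightarrow> j \<noteq> i \<Longrightarrow> \<exists>f\<in>F. f j \<noteq> f i"
    and "i < n" "w \<in> W" "w $ i \<noteq> 0"
  shows "unit_vec n i \<in> W"
  using assms(5,6)
proof (induction "card {j. j < n \<and> w $ j \<noteq> 0}" arbitrary: w rule: less_induct)
  case less
  note W = subspace_vecD[OF sub]
  have w: "w \<in> carrier_vec n" using less.prems W by auto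
  show ?case
  proof (cases "\<exists>j<n. j \<noteq> i \<and> w $ j \<noteq> 0")
    case True
    then obtain j where j: "j < n" "j \<noteq> i" "w $ j \<noteq> 0" by auto
    then obtain f where f: "f \<in> F" "f j \<noteq> f i" using sep by auto
    define w' where "w' = mat_diag n f *\<^sub>v w + (- f j) \<cdot>\<^sub>v w"
    have w': "w' $ k = (f k - f j) * w $ k" if "k < n" for k
      using that w mult_mat_diag_vec_index[OF w that]
      by (simp add: w'_def algebra_simps del: index_mult_mat_vec)
    have "w' \<in> W"
      unfolding w'_def by (intro W inv f less.prems)
    moreover have "w' $ i \<noteq> 0"
      using w' \<open>i < n\<close> f less.prems by auto
    moreover have "{k. k < n \<and> w' $ k \<noteq> 0} \<subset> {k. k < n \<and> w $ k \<noteq> 0}"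
    proof (rule psubsetI)
      show "{k. k < n \<and> w' $ k \<noteq> 0} \<subseteq> {k. k < n \<and> w $ k \<noteq> 0}" using w' by auto
      have "j \<notin> {k. k < n \<and> w' $ k \<noteq> 0}" "j \<in> {k. k < n \<and> w $ k \<noteq> 0}"
        using w' j by auto
      then show "{k. k < n \<and> w' $ k \<noteq> 0} \<noteq> {k. k < n \<and> w $ k \<noteq> 0}" by metis
    qed
    then have "card {k. k < n \<and> w' $ k \<noteq> 0} < card {k. k < n \<and> w $ k \<noteq> 0}"
      by (intro psubset_card_mono) auto
    ultimately show ?thesis using less.hyps by blast
  next
    case False
    then have "unit_vec n i = inverse (w $ i) \<cdot>\<^sub>v w"
      using w less.prems \<open>i < n\<close> by (intro eq_vecI) auto
    then show ?thesis using W(4) less.prems by simp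
  qed
qed

lemma mult_mat_unit_vec_index:
  assumes "T \<in> carrier_mat n n" "i < n" "j < n"
  shows "(T *\<^sub>v unit_vec n j) $ i = (T $$ (i, j) :: 'a :: semiring_1)"
  using assms by (simp add: scalar_prod_right_unit)

lemma unit_vecs_generate_subspace:
  fixes W :: "'a :: field vec set"
  assumes sub: "VectorSpace.subspace class_ring W (module_vec TYPE('a) n)"
    and unit: "\<And>i. i < n \<Longrightarrow> unit_vec n i \<in> W"
  shows "W = carrier_vec n"
proof
  note W = subspace_vecD[OF sub]
  show "W \<subseteq> carrier_vec n" by (rule W)
  show "carrier_vec n \<subseteq> W"
  proof
    fix v :: "'a vec" assume v: "v \<in> carrier_vec n"
    \<comment> \<open>The truncations of \<open>v\<close> arise by adding one multiple of a unit vector at a time.\<close>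
    have "vec n (\<lambda>i. if i < k then v $ i else 0) \<in> W" if "k \<le> n" for k
      using that
    proof (induction k)
      case 0
      have "vec n (\<lambda>i. if i < 0 then v $ i else 0) = 0\<^sub>v n" by auto
      then show ?case using W(2) by simp
    next
      case (Suc k)
      have "vec n (\<lambda>i. if i < Suc k then v $ i else 0) =
          vec n (\<lambda>i. if i < k then v $ i else 0) + v $ k \<cdot>\<^sub>v unit_vec n k"
        using Suc.prems by (intro eq_vecI) (auto simp: less_Suc_eq)
      then show ?case using Suc by (simp add: W(3,4) unit)
    qed
    from this[of n] have "vec n (\<lambda>i. if i < n then v $ i else 0) \<in> W" by simp
    also have "vec n (\<lambda>i. if i < n then v $ i else 0) = v"
      using v by auto
    finally show "v \<in> W" .
  qed
qed

text \<open>The irreducibility criterion. A nonzero invariant subspace contains a unit vector, because the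
  diagonal operators separate the coordinates. If it contains the \<open>j\<close>-th unit vector, then it
  contains the \<open>j\<close>-th column of every matrix in \<open>\<T>\<close>, and hence, by separation again, each unit
  vector at which such a column does not vanish. The matrices in \<open>\<T>\<close> link neighbouring indices in both
  directions, so every unit vector is reached.\<close>
lemma invariant_subspace_trivial:
  fixes W :: "'a :: field vec set"
  assumes sub: "VectorSpace.subspace class_ring W (module_vec TYPE('a) n)"
    and inv: "\<And>f w. f \<in> F \<Longrightarrow> w \<in> W \<Longrightarrow> mat_diag n f *\<^sub>v w \<in> W"
    and sep: "\<And>i j. i < n \<Longrightarrow> j < n \<Longrightarrow> j \<noteq> i \<Longrightarrow> \<exists>f\<in>F. f j \<noteq> f i"
    and carr: "\<And>T. T \<in> \<T> \<Longrightarrow> T \<in> carrier_mat n n"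
    and invT: "\<And>T w. T \<in> \<T> \<Longrightarrow> w \<in> W \<Longrightarrow> T *\<^sub>v w \<in> W"
    and link: "\<And>i. Suc i < n \<Longrightarrow> \<exists>T\<in>\<T>. T $$ (i, Suc i) \<noteq> 0 \<and> T $$ (Suc i, i) \<noteq> 0"
    and "W \<noteq> {0\<^sub>v n}"
  shows "W = carrier_vec n"
proof (rule unit_vecs_generate_subspace[OF sub])
  note W = subspace_vecD[OF sub]
  have pick: "unit_vec n i \<in> W" if "i < n" "w \<in> W" "w $ i \<noteq> 0" for i w
    using unit_vec_mem_of_separating_diagonals[OF sub inv sep] that by blast
  have move: "unit_vec n i \<in> W"
    if "T \<in> \<T>" "T $$ (i, j) \<noteq> 0" "i < n" "j < n" "unit_vec n j \<in> W" for T i j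
    using that mult_mat_unit_vec_index[OF carr] by (intro pick[of i "T *\<^sub>v unit_vec n j"] invT) auto
  obtain w where w: "w \<in> W" "w \<noteq> 0\<^sub>v n" using assms(7) W(2) by auto
  then obtain k where k: "k < n" "w $ k \<noteq> 0"
    using W(1) by (metis carrier_vecD eq_vecI index_zero_vec(1) index_zero_vec(2) subsetD)
  have kW: "unit_vec n k \<in> W" using pick[OF k(1) w(1) k(2)] .
  fix i assume i: "i < n"
  show "unit_vec n i \<in> W"
  proof (cases "k \<le> i")
    case True
    then show ?thesis using i
    proof (induction i rule: dec_induct)
      case (step m)
      then show ?case using link[of m] move[of _ "Suc m" m] by auto
    qed (rule kW)
  next
    case False
    then have "i \<le> k" by simp
    then show ?thesis
    proof (induction i rule: inc_induct)
      case (step m)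
      then show ?case using link[of m] move[of _ m "Suc m"] k by auto
    qed (rule kW)
  qed
qed

lemma diagonalizable_mat_diag: "diagonalizable (mat_diag n f)"
  unfolding diagonalizable_def
  by (intro exI[of _ "mat_diag n f"] conjI similar_mat_refl[OF mat_diag_dim])
    (auto simp: diagonal_mat_def mat_diag_def)

lemma dim_line:
  fixes v :: "'a :: field vec"
  assumes v: "v \<in> carrier_vec n" "v \<noteq> 0\<^sub>v n"
  shows "vectorspace.dim class_ring
    ((module_vec TYPE('a) n)\<lparr>carrier := range (\<lambda>a. a \<cdot>\<^sub>v v)\<rparr>) = 1"
proof -
  let ?V = "module_vec TYPE('a) n" and ?L = "range (\<lambda>a. a \<cdot>\<^sub>v v)"
  interpret V: vectorspace "class_ring :: 'a ring" ?V by (rule vec_vs)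
  have v': "{v} \<subseteq> carrier ?V" using v by (simp add: module_vec_simps)
  have span: "V.span {v} = ?L"
    using v by (auto simp: V.finite_span[OF _ v'] V.lincomb_def module_vec_simps class_ring_simps)
  have subL: "VectorSpace.subspace class_ring ?L ?V"
    using V.span_is_subspace[OF v'] by (simp add: span)
  interpret L: vectorspace "class_ring :: 'a ring" "?V\<lparr>carrier := ?L\<rparr>"
    by (rule V.subspace_is_vs[OF subL])
  have vL: "v \<in> ?L" by (rule range_eqI[of _ _ 1]) simp
  show ?thesis
  proof (rule L.dim1I)
    show "L.gen_set {v}"
      using V.span_li_not_depend(1)[of "{v}" ?L] subL vL span by simp
  qed (use vL v in \<open>auto simp: module_vec_simps\<close>)
qed

text \<open>For diagonal \<open>A\<close> and \<open>B\<close> a nonzero joint eigenvector determines, at each of its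
  nonzero entries \<open>i\<close>, the pair of eigenvalues \<open>(a i, b i)\<close>. If these pairs are distinct, there
  is only one such \<open>i\<close>, and the joint eigenspace is a coordinate axis.\<close>
lemma H_multiplicity_free_of_diagonal:
  assumes A: "\<rho> (H_A r0 r1) = mat_diag n a" and B: "\<rho> (H_B r0 r1) = mat_diag n b"
    and inj: "inj_on (\<lambda>i. (a i, b i)) {..<n}"
  shows "H_multiplicity_free r0 r1 n \<rho>"
proof -
  have "vectorspace.dim class_ring
      ((module_vec TYPE(complex) n)\<lparr>carrier := joint_eigenspace r0 r1 n \<rho> \<alpha> \<beta>\<rparr>) = 1"
    if ne: "joint_eigenspace r0 r1 n \<rho> \<alpha> \<beta> \<noteq> {0\<^sub>v n}" for \<alpha> \<beta>
  proof -
    have eig: "v \<in> joint_eigenspace r0 r1 n \<rho> \<alpha> \<beta> \<longleftrightarrow>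
        v \<in> carrier_vec n \<and> (\<forall>i<n. a i * v $ i = \<alpha> * v $ i \<and> b i * v $ i = \<beta> * v $ i)" for v
      by (auto simp: joint_eigenspace_def A B vec_eq_iff mult_mat_diag_vec_index
          simp del: index_mult_mat_vec) (auto simp: mat_diag_def)
    have "0\<^sub>v n \<in> joint_eigenspace r0 r1 n \<rho> \<alpha> \<beta>" by (simp add: eig)
    then obtain v where v: "v \<in> joint_eigenspace r0 r1 n \<rho> \<alpha> \<beta>" "v \<noteq> 0\<^sub>v n"
      using ne by blast
    then obtain i where i: "i < n" "v $ i \<noteq> 0" by (auto simp: eig vec_eq_iff)
    then have ab: "a i = \<alpha>" "b i = \<beta>" using v by (auto simp: eig)
    have "joint_eigenspace r0 r1 n \<rho> \<alpha> \<beta> = range (\<lambda>c. c \<cdot>\<^sub>v unit_vec n i)"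
    proof (intro equalityI subsetI)
      fix w assume w: "w \<in> joint_eigenspace r0 r1 n \<rho> \<alpha> \<beta>"
      have "w $ j = 0" if "j < n" "j \<noteq> i" for j
      proof (rule ccontr)
        assume "w $ j \<noteq> 0"
        then have "a j = \<alpha>" "b j = \<beta>" using w that by (auto simp: eig)
        then show False using inj_onD[OF inj, of j i] that i ab by auto
      qed
      then have "w = w $ i \<cdot>\<^sub>v unit_vec n i"
        using w i by (intro eq_vecI) (auto simp: eig)
      then show "w \<in> range (\<lambda>c. c \<cdot>\<^sub>v unit_vec n i)" by blast
    qed (use i ab in \<open>auto simp: eig\<close>)
    then show ?thesis using i by (simp add: dim_line)
  qed
  then show ?thesis
    by (simp add: H_multiplicity_free_def A B diagonalizable_mat_diag)
qed

section \<open>Block diagonal matrices\<close>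

lemma diag_block_mat_index:
  assumes "i < dim_row X" "j < dim_col X"
  shows "diag_block_mat (As @ X # Bs) $$
    (sum_list (map dim_row As) + i, sum_list (map dim_col As) + j) = X $$ (i, j)"
  using assms
  by (simp add: diag_block_mat_append Let_def dim_diag_block_mat)

lemma diag_block_mat_square_carriers:
  assumes "list_all2 (\<lambda>A B. dim_col A = dim_row A \<and> dim_row B = dim_row A \<and> dim_col B = dim_row A) As Bs"
  shows "\<exists>e. diag_block_mat As \<in> carrier_mat e e \<and> diag_block_mat Bs \<in> carrier_mat e e"
  using assms
proof (induction rule: list_all2_induct)
  case (Cons A As B Bs)
  then obtain e where "diag_block_mat As \<in> carrier_mat e e" "diag_block_mat Bs \<in> carrier_mat e e" by blast
  moreover obtain d where "A \<in> carrier_mat d d" "B \<in> carrier_mat d d" using Cons(1) by auto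
  ultimately show ?case by (intro exI[of _ "d + e"]) (simp add: Let_def)
qed (auto intro!: exI[of _ 0])

lemma diag_block_mat_mult:
  assumes "list_all2 (\<lambda>A B. dim_col A = dim_row A \<and> dim_row B = dim_row A \<and> dim_col B = dim_row A) As Bs"
  shows "diag_block_mat As * diag_block_mat Bs = diag_block_mat (map2 (*) As Bs)"
  using assms
proof (induction rule: list_all2_induct)
  case (Cons A As B Bs)
  obtain d where d: "A \<in> carrier_mat d d" "B \<in> carrier_mat d d" using Cons(1) by auto
  obtain e where e: "diag_block_mat As \<in> carrier_mat e e" "diag_block_mat Bs \<in> carrier_mat e e"
    using diag_block_mat_square_carriers[OF Cons(2)] by blast
  have "diag_block_mat (A # As) * diag_block_mat (B # Bs) =
      four_block_mat A (0\<^sub>m d e) (0\<^sub>m e d) (diag_block_mat As) *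
      four_block_mat B (0\<^sub>m d e) (0\<^sub>m e d) (diag_block_mat Bs)"
    using d e by (simp add: Let_def carrier_matD)
  also have "\<dots> = four_block_mat (A * B) (0\<^sub>m d e) (0\<^sub>m e d) (diag_block_mat As * diag_block_mat Bs)"
    by (subst mult_four_block_mat[OF d(1) _ _ e(1) d(2) _ _ e(2)])
      (use d e in \<open>simp_all add: left_add_zero_mat[of _ e e] right_add_zero_mat[of _ d d]\<close>)
  also have "\<dots> = diag_block_mat (map2 (*) (A # As) (B # Bs))"
    using d e by (simp add: Let_def Cons(3)[symmetric] carrier_matD)
  finally show ?case .
qed auto

lemma diag_block_mat_minus_scalar:
  fixes As :: "'a :: ring_1 mat list"
  assumes "Ball (set As) square_mat"
  shows "diag_block_mat As - a \<cdot>\<^sub>m 1\<^sub>m (sum_list (map dim_row As)) =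
    diag_block_mat (map (\<lambda>A. A - a \<cdot>\<^sub>m 1\<^sub>m (dim_row A)) As)"
  using assms
proof (induction As)
  case (Cons A As)
  define d where "d = dim_row A"
  define e where "e = sum_list (map dim_row As)"
  define P where "P = diag_block_mat As"
  have A: "A \<in> carrier_mat d d" using Cons.prems by (auto simp: d_def)
  have P: "P \<in> carrier_mat e e"
    using diag_block_mat_square[of As] Cons.prems by (auto simp: e_def P_def dim_diag_block_mat)
  have "four_block_mat A (0\<^sub>m d e) (0\<^sub>m e d) P - a \<cdot>\<^sub>m 1\<^sub>m (d + e) =
      four_block_mat (A - a \<cdot>\<^sub>m 1\<^sub>m d) (0\<^sub>m d e) (0\<^sub>m e d) (P - a \<cdot>\<^sub>m 1\<^sub>m e)"
    using A P by (intro eq_matI) auto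
  moreover have Q: "P - a \<cdot>\<^sub>m 1\<^sub>m e = diag_block_mat (map (\<lambda>A. A - a \<cdot>\<^sub>m 1\<^sub>m (dim_row A)) As)"
    using Cons by (simp add: P_def e_def)
  moreover have "diag_block_mat (map (\<lambda>A. A - a \<cdot>\<^sub>m 1\<^sub>m (dim_row A)) As) \<in> carrier_mat e e"
    unfolding Q[symmetric] by (intro minus_carrier_mat) simp
  ultimately show ?case
    using A P by (simp add: Let_def carrier_matD flip: d_def e_def P_def)
qed auto

lemma diag_block_mat_zero:
  "diag_block_mat (map (\<lambda>A. 0\<^sub>m (dim_row A) (dim_row A)) As) = 
    0\<^sub>m (sum_list (map dim_row As)) (sum_list (map dim_row As))"
  by (induction As) (auto intro!: eq_matI simp: Let_def)

lemma diagonal_diag_block_mat: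
  assumes "\<And>A. A \<in> set As \<Longrightarrow> square_mat A \<and> diagonal_mat A"
  shows "diagonal_mat (diag_block_mat As)"
  using assms
proof (induction As)
  case (Cons A As)
  have "dim_col (diag_block_mat As) = dim_row (diag_block_mat As)"
    using diag_block_mat_square[of As] Cons.prems by simp
  moreover have "dim_col A = dim_row A" using Cons.prems by simp
  ultimately show ?case
    using Cons by (auto simp: Let_def diagonal_mat_def)
qed (simp add: diagonal_mat_def)

lemma diag_block_mat_annihilated:
  fixes As :: "'a :: ring_1 mat list"
  assumes n: "n = sum_list (map dim_row As)"
    and blocks: "\<And>A. A \<in> set As \<Longrightarrow> square_mat A"
      "\<And>A. A \<in> set As \<Longrightarrow>
        (A - a \<cdot>\<^sub>m 1\<^sub>m (dim_row A)) * (A - b \<cdot>\<^sub>m 1\<^sub>m (dim_row A)) = 0\<^sub>m (dim_row A) (dim_row A)"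
  shows "(diag_block_mat As - a \<cdot>\<^sub>m 1\<^sub>m n) * (diag_block_mat As - b \<cdot>\<^sub>m 1\<^sub>m n) = 0\<^sub>m n n"
proof -
  let ?f = "\<lambda>x A. A - x \<cdot>\<^sub>m 1\<^sub>m (dim_row A)"
  have sq: "Ball (set As) square_mat" using blocks by blast
  have "list_all2 (\<lambda>A B. dim_col A = dim_row A \<and> dim_row B = dim_row A \<and> dim_col B = dim_row A)
      (map (?f a) As) (map (?f b) As)"
    using blocks by (auto simp: list_all2_map1 list_all2_map2 intro!: list.rel_refl_strong)
  then have "(diag_block_mat As - a \<cdot>\<^sub>m 1\<^sub>m n) * (diag_block_mat As - b \<cdot>\<^sub>m 1\<^sub>m n) =
      diag_block_mat (map2 (*) (map (?f a) As) (map (?f b) As))"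
    unfolding n diag_block_mat_minus_scalar[OF sq] by (rule diag_block_mat_mult)
  also have "map2 (*) (map (?f a) As) (map (?f b) As) = map (\<lambda>A. 0\<^sub>m (dim_row A) (dim_row A)) As"
    using blocks by (simp add: map2_map_map)
  finally show ?thesis by (simp add: diag_block_mat_zero n)
qed

text \<open>The two block patterns of the module: in the first, block \<open>k\<close> occupies the
  indices \<open>2 * k\<close> and \<open>2 * k + 1\<close>; in the second, a leading block of size one shifts the pattern
  by one, so block \<open>k\<close> occupies \<open>2 * k - 1\<close> and \<open>2 * k\<close>.\<close>
lemma diag_block_mat_paired_index:
  assumes f: "\<And>i. i < D \<Longrightarrow> f i \<in> carrier_mat 2 2" and "k < D" "i < 2" "j < 2"
  shows "diag_block_mat (map f [0..<D]) $$ (2 * k + i, 2 * k + j) = f k $$ (i, j)"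
proof -
  have "[0..<D] = [0..<k] @ k # [Suc k..<D]"
    using \<open>k < D\<close> upt_add_eq_append[of 0 k "D - k"] by (simp add: upt_conv_Cons)
  moreover have "map dim_row (map f [0..<k]) = map (\<lambda>_. 2) [0..<k]"
    "map dim_col (map f [0..<k]) = map (\<lambda>_. 2) [0..<k]"
    using carrier_matD[OF f] \<open>k < D\<close> by auto
  ultimately show ?thesis
    using diag_block_mat_index[of i "f k" j "map f [0..<k]" "map f [Suc k..<D]"] assms f[OF \<open>k < D\<close>]
    by (simp add: sum_list_triv mult.commute del: map_map)
qed

lemma diag_block_mat_shifted_index:
  assumes f: "\<And>i. 1 \<le> i \<Longrightarrow> i < D \<Longrightarrow> f i \<in> carrier_mat 2 2"
    and X: "X \<in> carrier_mat 1 1" and Y: "Y \<in> carrier_mat 1 1"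
    and k: "1 \<le> k" "k < D" and ij: "i < 2" "j < 2"
  shows "diag_block_mat (X # map f [1..<D] @ [Y]) $$ (2 * k - 1 + i, 2 * k - 1 + j) = f k $$ (i, j)"
proof -
  have "[1..<D] = [1..<k] @ k # [Suc k..<D]"
    using k upt_add_eq_append[of 1 k "D - k"] by (simp add: upt_conv_Cons)
  moreover have "map dim_row (map f [1..<k]) = map (\<lambda>_. 2) [1..<k]"
    "map dim_col (map f [1..<k]) = map (\<lambda>_. 2) [1..<k]"
    using carrier_matD[OF f] k by auto
  moreover have "1 + (k - 1) * 2 = 2 * k - 1" using k by simp
  ultimately show ?thesis
    using diag_block_mat_index[of i "f k" j "X # map f [1..<k]" "map f [Suc k..<D] @ [Y]"]
      f[of k] X ij k
    by (simp add: sum_list_triv del: map_map)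
qed

lemma diag_block_mat_corner_index:
  assumes f: "\<And>i. 1 \<le> i \<Longrightarrow> i < D \<Longrightarrow> f i \<in> carrier_mat 2 2"
    and X: "X \<in> carrier_mat 1 1" and Y: "Y \<in> carrier_mat 1 1" and D: "D \<ge> 1"
  shows "diag_block_mat (X # map f [1..<D] @ [Y]) $$ (0, 0) = X $$ (0, 0)"
    and "diag_block_mat (X # map f [1..<D] @ [Y]) $$ (2 * D - 1, 2 * D - 1) = Y $$ (0, 0)"
proof -
  show "diag_block_mat (X # map f [1..<D] @ [Y]) $$ (0, 0) = X $$ (0, 0)"
    using diag_block_mat_index[of 0 X 0 "[]" "map f [1..<D] @ [Y]"] X by simp
  have "map dim_row (map f [1..<D]) = map (\<lambda>_. 2) [1..<D]"
    "map dim_col (map f [1..<D]) = map (\<lambda>_. 2) [1..<D]"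
    using carrier_matD[OF f] by auto
  moreover have "1 + (D - 1) * 2 = 2 * D - 1" using D by simp
  ultimately show "diag_block_mat (X # map f [1..<D] @ [Y]) $$ (2 * D - 1, 2 * D - 1) = Y $$ (0, 0)"
    using diag_block_mat_index[of 0 Y 0 "X # map f [1..<D]" "[]"] X Y
    by (simp add: sum_list_triv del: map_map)
qed

section \<open>The matrices of the module\<close>

lemma mat2_mult:
  "mat_of_rows_list 2 [[a, b], [c, d]] * mat_of_rows_list 2 [[e, f], [g, h]] =
   mat_of_rows_list 2 [[a * e + b * g, a * f + b * h], [c * e + d * g, c * f + d * (h :: 'a :: semiring_0)]]"
  by (auto intro!: eq_matI simp: mat_of_rows_list_def scalar_prod_def less_Suc_eq numeral_2_eq_2)

lemma mat2_minus_scalar: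
  "mat_of_rows_list 2 [[a, b], [c, d]] - x \<cdot>\<^sub>m 1\<^sub>m 2 =
   mat_of_rows_list 2 [[a - x, b], [c, d - (x :: 'a :: ring_1)]]"
  by (auto intro!: eq_matI simp: mat_of_rows_list_def less_Suc_eq numeral_2_eq_2)

lemma mat2_zero: "0\<^sub>m 2 2 = mat_of_rows_list 2 [[0, 0], [0, 0]]"
  by (auto intro!: eq_matI simp: mat_of_rows_list_def less_Suc_eq numeral_2_eq_2)

lemma block_dim [simp]:
  "dim_row (R_block r l c) = 2" "dim_row (P_block c) = 2"
  "dim_row (S_block r s) = 2" "dim_row (N_block s m) = 2" "dim_row (one_block a) = 1"
  "dim_col (R_block r l c) = 2" "dim_col (P_block c) = 2"
  "dim_col (S_block r s) = 2" "dim_col (N_block s m) = 2" "dim_col (one_block a) = 1"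
  by (simp_all add: R_block_def P_block_def S_block_def N_block_def one_block_def mat_of_rows_list_def)

lemma block_carrier [simp]:
  "R_block r l c \<in> carrier_mat 2 2" "P_block c \<in> carrier_mat 2 2"
  "S_block r s \<in> carrier_mat 2 2" "N_block s m \<in> carrier_mat 2 2"
  "one_block a \<in> carrier_mat 1 1"
  by (simp_all add: carrier_matI)

lemma E_matrix_carrier:
  assumes "D \<ge> 1"
  shows "E_matrix D r0 r1 rm rp c s l m g \<in> carrier_mat (2 * D) (2 * D)"
  using assms
  by (cases g; intro carrier_matI)
    (simp_all add: E_matrix_def dim_diag_block_mat comp_def sum_list_triv del: diag_block_mat.simps)

text \<open>The reason why \<open>A\<close> is diagonal: multiplying \<^const>\<open>R_block\<close> by the row \<open>(1, c)\<close> from the left cancels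
  the second column and leaves \<open>l\<close> in the first.\<close>
lemma P_block_mult_R_block:
  assumes c: "c \<noteq> 0"
  shows "P_block c * R_block r l c = mat_diag 2 (\<lambda>j. if j = 0 then l else 0)"
  unfolding P_block_def R_block_def mat2_mult
  by (auto intro!: eq_matI simp: mat_of_rows_list_def mat_diag_def less_Suc_eq numeral_2_eq_2
      mult.assoc[symmetric] c)

lemma S_block_mult_N_block:
  assumes "s \<noteq> 0"
  shows "S_block r s * N_block s m = mat_diag 2 (\<lambda>j. if j = 0 then m else 0)"
  unfolding S_block_def N_block_def mat2_mult using assms
  by (auto intro!: eq_matI simp: mat_of_rows_list_def mat_diag_def less_Suc_eq numeral_2_eq_2 algebra_simps)

text \<open>The block has trace \<open>kk r\<close> and determinant one, so its characteristic polynomial is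
  \<open>(x - r) (x - inverse r)\<close>; the same holds for the next block.\<close>
lemma R_block_annihilated:
  assumes "r \<noteq> 0" "l \<noteq> 0" "c \<noteq> 0"
  shows "(R_block r l c - r \<cdot>\<^sub>m 1\<^sub>m 2) * (R_block r l c - inverse r \<cdot>\<^sub>m 1\<^sub>m 2) = 0\<^sub>m 2 2"
  unfolding R_block_def mat2_mult mat2_minus_scalar mat2_zero kk_def
  using assms by (simp add: field_simps)

lemma S_block_annihilated:
  assumes "r \<noteq> 0" "s \<noteq> 0"
  shows "(S_block r s - r \<cdot>\<^sub>m 1\<^sub>m 2) * (S_block r s - inverse r \<cdot>\<^sub>m 1\<^sub>m 2) = 0\<^sub>m 2 2"
  unfolding S_block_def mat2_mult mat2_minus_scalar mat2_zero kk_def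
  using assms by (simp add: field_simps)

lemma P_block_idem: "P_block c * P_block c = P_block c"
  by (simp add: P_block_def mat2_mult)

lemma N_block_square: "N_block s m * N_block s m = 0\<^sub>m 2 2"
  by (simp add: N_block_def mat2_mult mat2_zero)

lemma one_block_mult: "one_block a * one_block b = one_block (a * b)"
  by (auto intro!: eq_matI simp: one_block_def mat_of_rows_list_def scalar_prod_def)

lemma one_block_annihilated:
  assumes "a \<in> {r, inverse r}"
  shows "(one_block a - r \<cdot>\<^sub>m 1\<^sub>m 1) * (one_block a - inverse r \<cdot>\<^sub>m 1\<^sub>m 1) = 0\<^sub>m 1 1"
  using assms by (auto intro!: eq_matI simp: one_block_def mat_of_rows_list_def scalar_prod_def)

text \<open>In the ordered basis \<open>b\<^sub>0, a\<^sub>1, b\<^sub>1, \<dots>, a\<^sub>D\<close>, counted from zero, \<open>b\<^sub>i\<close> has index \<open>2 * i\<close>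
  and \<open>a\<^sub>i\<close> has index \<open>2 * i - 1\<close>. The next two functions give the diagonals of \<open>A\<close> and \<open>B\<close>:
  \<open>A\<close> kills every \<open>b\<^sub>i\<close>, and \<open>B\<close> kills every \<open>a\<^sub>i\<close>.\<close>
definition a_eigenvalue :: "nat \<Rightarrow> complex \<Rightarrow> (nat \<Rightarrow> complex) \<Rightarrow> nat \<Rightarrow> complex" where
  "a_eigenvalue D rp l i = (if even i then 0 else if i = 2 * D - 1 then rp else l ((i + 1) div 2))"

definition b_eigenvalue :: "(nat \<Rightarrow> complex) \<Rightarrow> nat \<Rightarrow> complex" where
  "b_eigenvalue m i = (if even i then m (i div 2) else 0)"

lemma E_U0_mult_T0:
  assumes D: "D \<ge> 1" and c: "\<forall>i\<in>{1..<D}. c i \<noteq> 0"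
  shows "E_matrix D r0 r1 rm rp c s l m U0 * E_matrix D r0 r1 rm rp c s l m T0 =
    mat_diag (2 * D) (a_eigenvalue D rp l)" (is "?U * ?T = _")
proof -
  define F where "F i = mat_diag 2 (\<lambda>j. if j = 0 then l i else 0 :: complex)" for i
  define As where "As = one_block 0 # map F [1..<D] @ [one_block rp]"
  have F: "F i \<in> carrier_mat 2 2" for i by (simp add: F_def)
  have "?U * ?T = diag_block_mat (map2 (*)
      (one_block 0 # map (\<lambda>i. P_block (c i)) [1..<D] @ [one_block 1])
      (one_block rm # map (\<lambda>i. R_block r0 (l i) (c i)) [1..<D] @ [one_block rp]))"
    unfolding E_matrix_def gen.case append_Cons append_Nil
    by (rule diag_block_mat_mult)
      (auto simp: list_all2_map1 list_all2_map2 intro!: list_all2_appendI list.rel_refl_strong)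
  also have "map2 (*)
      (one_block 0 # map (\<lambda>i. P_block (c i)) [1..<D] @ [one_block 1])
      (one_block rm # map (\<lambda>i. R_block r0 (l i) (c i)) [1..<D] @ [one_block rp]) = As"
    using c by (simp add: map2_map_map one_block_mult P_block_mult_R_block As_def F_def)
  finally have UT: "?U * ?T = diag_block_mat As" .
  have carrier: "diag_block_mat As \<in> carrier_mat (2 * D) (2 * D)"
    unfolding UT[symmetric] by (rule mult_carrier_mat[OF E_matrix_carrier[OF D] E_matrix_carrier[OF D]])
  have diag: "diagonal_mat (diag_block_mat As)"
    by (rule diagonal_diag_block_mat)
      (auto simp: As_def F_def mat_diag_def diagonal_mat_def)
  have "diag_block_mat As = mat_diag (2 * D) (a_eigenvalue D rp l)"
  proof (rule eq_matI)
    fix i j assume "i < dim_row (mat_diag (2 * D) (a_eigenvalue D rp l))"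
      "j < dim_col (mat_diag (2 * D) (a_eigenvalue D rp l))"
    then have ij: "i < 2 * D" "j < 2 * D" by (auto simp: mat_diag_def)
    have "diag_block_mat As $$ (i, i) = a_eigenvalue D rp l i"
    proof -
      \<comment> \<open>The leading block, the last block, and the two diagonal positions in the block of size
        two with number \<open>k\<close>.\<close>
      consider "i = 0" | "i = 2 * D - 1" | k where "1 \<le> k" "k < D" "i = 2 * k - 1 + 0"
        | k where "1 \<le> k" "k < D" "i = 2 * k - 1 + 1"
      proof (cases "even i")
        case True
        then obtain k where "i = 2 * k" by (auto elim: evenE)
        then show ?thesis using that(1) that(4)[of k] ij by (cases "k = 0") auto
      next
        case False
        then obtain k where "i = 2 * k + 1" by (auto elim: oddE)
        then show ?thesis using that(2) that(3)[of "k + 1"] ij by (cases "k + 1 = D") auto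
      qed
      then show ?thesis
      proof cases
        case 1
        then show ?thesis
          using diag_block_mat_corner_index(1)[of D F "one_block 0" "one_block rp"] F D
          by (simp add: As_def a_eigenvalue_def del: diag_block_mat.simps)
            (simp add: one_block_def mat_of_rows_list_def)
      next
        case 2
        then show ?thesis
          using diag_block_mat_corner_index(2)[of D F "one_block 0" "one_block rp"] F D
          by (simp add: As_def a_eigenvalue_def del: diag_block_mat.simps)
            (simp add: one_block_def mat_of_rows_list_def)
      next
        case (3 k)
        then show ?thesis
          using diag_block_mat_shifted_index[of D F "one_block 0" "one_block rp" k 0 0,
              OF F block_carrier(5) block_carrier(5) 3(1,2)]
          by (auto simp: As_def a_eigenvalue_def F_def mat_diag_def simp del: diag_block_mat.simps)
      next
        case (4 k)
        then show ?thesis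
          using diag_block_mat_shifted_index[of D F "one_block 0" "one_block rp" k 1 1,
              OF F block_carrier(5) block_carrier(5) 4(1,2)]
          by (auto simp: As_def a_eigenvalue_def F_def mat_diag_def simp del: diag_block_mat.simps)
      qed
    qed
    then show "diag_block_mat As $$ (i, j) = mat_diag (2 * D) (a_eigenvalue D rp l) $$ (i, j)"
      using ij diag carrier by (auto simp: diagonal_mat_def mat_diag_def)
  qed (use carrier in \<open>auto simp: mat_diag_def\<close>)
  with UT show ?thesis by simp
qed

lemma E_T1_mult_U1:
  assumes D: "D \<ge> 1" and s: "\<forall>i\<in>{0..<D}. s i \<noteq> 0"
  shows "E_matrix D r0 r1 rm rp c s l m T1 * E_matrix D r0 r1 rm rp c s l m U1 =
    mat_diag (2 * D) (b_eigenvalue m)" (is "?T * ?U = _")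
proof -
  define F where "F i = mat_diag 2 (\<lambda>j. if j = 0 then m i else 0 :: complex)" for i
  have F: "F i \<in> carrier_mat 2 2" for i by (simp add: F_def)
  have "?T * ?U = diag_block_mat (map2 (*)
      (map (\<lambda>i. S_block r1 (s i)) [0..<D]) (map (\<lambda>i. N_block (s i) (m i)) [0..<D]))"
    unfolding E_matrix_def gen.case
    by (rule diag_block_mat_mult)
      (auto simp: list_all2_map1 list_all2_map2 intro!: list.rel_refl_strong)
  also have "map2 (*)
      (map (\<lambda>i. S_block r1 (s i)) [0..<D]) (map (\<lambda>i. N_block (s i) (m i)) [0..<D]) = map F [0..<D]"
    using s by (simp add: map2_map_map S_block_mult_N_block F_def)
  finally have TU: "?T * ?U = diag_block_mat (map F [0..<D])" .
  have carrier: "diag_block_mat (map F [0..<D]) \<in> carrier_mat (2 * D) (2 * D)"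
    unfolding TU[symmetric] by (rule mult_carrier_mat[OF E_matrix_carrier[OF D] E_matrix_carrier[OF D]])
  have diag: "diagonal_mat (diag_block_mat (map F [0..<D]))"
    by (rule diagonal_diag_block_mat) (auto simp: F_def mat_diag_def diagonal_mat_def)
  have "diag_block_mat (map F [0..<D]) = mat_diag (2 * D) (b_eigenvalue m)"
  proof (rule eq_matI)
    fix i j assume "i < dim_row (mat_diag (2 * D) (b_eigenvalue m))"
      "j < dim_col (mat_diag (2 * D) (b_eigenvalue m))"
    then have ij: "i < 2 * D" "j < 2 * D" by (auto simp: mat_diag_def)
    have "diag_block_mat (map F [0..<D]) $$ (2 * (i div 2) + i mod 2, 2 * (i div 2) + i mod 2) =
        F (i div 2) $$ (i mod 2, i mod 2)"
      using ij by (intro diag_block_mat_paired_index F) auto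
    then have "diag_block_mat (map F [0..<D]) $$ (i, i) = b_eigenvalue m i"
      by (auto simp: F_def mat_diag_def b_eigenvalue_def even_iff_mod_2_eq_zero)
    then show "diag_block_mat (map F [0..<D]) $$ (i, j) = mat_diag (2 * D) (b_eigenvalue m) $$ (i, j)"
      using ij diag carrier by (auto simp: diagonal_mat_def mat_diag_def)
  qed (use carrier in \<open>auto simp: mat_diag_def\<close>)
  with TU show ?thesis by simp
qed

text \<open>The quadratic relations hold block by block. The two mixed relations couple the two block
  patterns; they hold because \<open>A\<close> and \<open>B\<close> are diagonal with disjoint supports.\<close>
lemma E_relations:
  fixes m :: "nat \<Rightarrow> complex"
  assumes D: "D \<ge> 1" and r: "r0 \<noteq> 0" "r1 \<noteq> 0"
    and rho: "rm \<in> {r0, inverse r0}" "rp \<in> {r0, inverse r0}"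
    and c: "\<forall>i\<in>{1..<D}. c i \<noteq> 0" and s: "\<forall>i\<in>{0..<D}. s i \<noteq> 0" and l: "\<forall>i\<in>{1..<D}. l i \<noteq> 0"
  defines "M \<equiv> E_matrix D r0 r1 rm rp c s l m"
  shows "(M T0 - r0 \<cdot>\<^sub>m 1\<^sub>m (2 * D)) * (M T0 - inverse r0 \<cdot>\<^sub>m 1\<^sub>m (2 * D)) = 0\<^sub>m (2 * D) (2 * D)"
    and "(M T1 - r1 \<cdot>\<^sub>m 1\<^sub>m (2 * D)) * (M T1 - inverse r1 \<cdot>\<^sub>m 1\<^sub>m (2 * D)) = 0\<^sub>m (2 * D) (2 * D)"
    and "M U0 * M U0 = M U0"
    and "M U1 * M U1 = 0\<^sub>m (2 * D) (2 * D)"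
    and "(M U0 * M T0) * (M T1 * M U1) = 0\<^sub>m (2 * D) (2 * D)"
    and "(M T1 * M U1) * (M U0 * M T0) = 0\<^sub>m (2 * D) (2 * D)"
proof -
  show "(M T0 - r0 \<cdot>\<^sub>m 1\<^sub>m (2 * D)) * (M T0 - inverse r0 \<cdot>\<^sub>m 1\<^sub>m (2 * D)) = 0\<^sub>m (2 * D) (2 * D)"
    unfolding M_def E_matrix_def gen.case
    using D r(1) c l one_block_annihilated[OF rho(1)] one_block_annihilated[OF rho(2)]
    by (intro diag_block_mat_annihilated) (auto simp: comp_def sum_list_triv R_block_annihilated)
  show "(M T1 - r1 \<cdot>\<^sub>m 1\<^sub>m (2 * D)) * (M T1 - inverse r1 \<cdot>\<^sub>m 1\<^sub>m (2 * D)) = 0\<^sub>m (2 * D) (2 * D)"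
    unfolding M_def E_matrix_def gen.case
    using r(2) s
    by (intro diag_block_mat_annihilated) (auto simp: comp_def sum_list_triv S_block_annihilated)
  have "M U0 * M U0 = diag_block_mat (map2 (*)
      (one_block 0 # map (\<lambda>i. P_block (c i)) [1..<D] @ [one_block 1])
      (one_block 0 # map (\<lambda>i. P_block (c i)) [1..<D] @ [one_block 1]))"
    unfolding M_def E_matrix_def gen.case append_Cons append_Nil
    by (rule diag_block_mat_mult)
      (auto simp: list_all2_map1 list_all2_map2 intro!: list_all2_appendI list.rel_refl_strong)
  then show "M U0 * M U0 = M U0"
    by (simp add: map2_map_map one_block_mult P_block_idem M_def E_matrix_def del: diag_block_mat.simps)
  have "M U1 * M U1 = diag_block_mat (map2 (*)
      (map (\<lambda>i. N_block (s i) (m i)) [0..<D]) (map (\<lambda>i. N_block (s i) (m i)) [0..<D]))"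
    unfolding M_def E_matrix_def gen.case
    by (rule diag_block_mat_mult)
      (auto simp: list_all2_map1 list_all2_map2 intro!: list.rel_refl_strong)
  then show "M U1 * M U1 = 0\<^sub>m (2 * D) (2 * D)"
    using diag_block_mat_zero[of "map (\<lambda>i. N_block (s i) (m i)) [0..<D]"]
    by (simp add: map2_map_map N_block_square comp_def sum_list_triv mult.commute)
  have disjoint: "a_eigenvalue D rp l i * b_eigenvalue m i = 0" for i
    by (simp add: a_eigenvalue_def b_eigenvalue_def)
  have zero: "mat_diag (2 * D) (\<lambda>_. 0) = 0\<^sub>m (2 * D) (2 * D)"
    by (auto simp: mat_diag_def)
  show "(M U0 * M T0) * (M T1 * M U1) = 0\<^sub>m (2 * D) (2 * D)"
    unfolding M_def E_U0_mult_T0[OF D c] E_T1_mult_U1[OF D s]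
    by (simp add: disjoint zero)
  show "(M T1 * M U1) * (M U0 * M T0) = 0\<^sub>m (2 * D) (2 * D)"
    unfolding M_def E_U0_mult_T0[OF D c] E_T1_mult_U1[OF D s]
    by (simp add: disjoint zero mult.commute[of "b_eigenvalue m _"])
qed

text \<open>The consecutive basis vectors \<open>b\<^sub>k, a\<^bsub>k+1\<^esub>\<close> share a block of \<open>t\<^sub>1\<close>, and \<open>a\<^sub>q, b\<^sub>q\<close> share a
  block of \<open>t\<^sub>0\<close>. Of their off-diagonal entries only the lower left one of the latter could vanish, and
  it does so only if \<open>l q\<close> is \<open>r0\<close> or its inverse.\<close>
lemma E_links:
  fixes m :: "nat \<Rightarrow> complex" and r1 rm rp :: complex
  assumes r0: "r0 \<noteq> 0"
    and c: "\<forall>i\<in>{1..<D}. c i \<noteq> 0" and s: "\<forall>i\<in>{0..<D}. s i \<noteq> 0" and l: "\<forall>i\<in>{1..<D}. l i \<noteq> 0"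
    and lr: "\<forall>i\<in>{1..<D}. l i \<notin> {r0, inverse r0}"
    and i: "Suc i < 2 * D"
  defines "M \<equiv> E_matrix D r0 r1 rm rp c s l m"
  shows "\<exists>T\<in>{M T0, M T1}. T $$ (i, Suc i) \<noteq> 0 \<and> T $$ (Suc i, i) \<noteq> 0"
proof (cases "even i")
  case True
  then obtain k where k: "i = 2 * k" by (auto elim: evenE)
  then have kD: "k < D" using i by simp
  have "M T1 $$ (2 * k + p, 2 * k + q) = S_block r1 (s k) $$ (p, q)" if "p < 2" "q < 2" for p q
    unfolding M_def E_matrix_def gen.case
    using that kD by (intro diag_block_mat_paired_index) auto
  from this[of 0 1] this[of 1 0] show ?thesis
    using s kD by (auto simp: k S_block_def mat_of_rows_list_def)
next
  case False
  then obtain k where k': "i = 2 * k + 1" by (auto elim: oddE)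
  define q where "q = k + 1"
  have q: "1 \<le> q" "q < D" "i = 2 * q - 1" using i k' by (auto simp: q_def)
  have entry: "M T0 $$ (2 * q - 1 + a, 2 * q - 1 + b) = R_block r0 (l q) (c q) $$ (a, b)"
    if "a < 2" "b < 2" for a b
    unfolding M_def E_matrix_def gen.case append_Cons append_Nil
    using that q by (intro diag_block_mat_shifted_index) auto
  have nz: "c q \<noteq> 0" "l q \<noteq> 0" "l q \<noteq> r0" "l q \<noteq> inverse r0" using c l lr q by auto
  \<comment> \<open>The lower left entry of the block, up to a unit, factors over the forbidden values of \<open>l q\<close>.\<close>
  have "l q * (l q - kk r0 + inverse (l q)) = (l q - r0) * (l q - inverse r0)"
    using nz r0 by (simp add: kk_def field_simps)
  then have "l q - kk r0 + inverse (l q) \<noteq> 0" using nz by auto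
  then show ?thesis
    using entry[of 0 1] entry[of 1 0] nz q by (auto simp: R_block_def mat_of_rows_list_def)
qed

text \<open>The eigenvalue of \<open>B\<close> is nonzero exactly at the \<open>b\<^sub>i\<close>, so it tells the two kinds of basis
  vectors apart. Within each kind the parameters are distinct; the last vector \<open>a\<^sub>D\<close> has eigenvalue
  \<open>r0\<close> or its inverse, which the other \<open>a\<^sub>i\<close> avoid.\<close>
lemma eigenvalue_pairs_inj:
  assumes rho: "rp \<in> {r0, inverse r0}"
    and m_nz: "\<forall>i\<in>{0..<D}. m i \<noteq> 0"
    and l: "inj_on l {1..<D}" and lr: "\<forall>i\<in>{1..<D}. l i \<notin> {r0, inverse r0}" and m: "inj_on m {0..<D}"
  shows "inj_on (\<lambda>i. (a_eigenvalue D rp l i, b_eigenvalue m i)) {..<2 * D}"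
proof (rule inj_onI)
  fix i j assume ij: "i \<in> {..<2 * D}" "j \<in> {..<2 * D}"
    and "(a_eigenvalue D rp l i, b_eigenvalue m i) = (a_eigenvalue D rp l j, b_eigenvalue m j)"
  then have eq: "a_eigenvalue D rp l i = a_eigenvalue D rp l j" "b_eigenvalue m i = b_eigenvalue m j"
    by auto
  have b_nz: "b_eigenvalue m k \<noteq> 0 \<longleftrightarrow> even k" if "k < 2 * D" for k
    using m_nz that by (auto simp: b_eigenvalue_def)
  have parity: "even i \<longleftrightarrow> even j" using b_nz[of i] b_nz[of j] eq ij by simp
  show "i = j"
  proof (cases "even i")
    case True
    then have "m (i div 2) = m (j div 2)" using eq parity by (simp add: b_eigenvalue_def)
    then have "i div 2 = j div 2" using inj_onD[OF m] ij by auto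
    then show ?thesis using True parity by (metis even_two_times_div_two)
  next
    case False
    have range: "(k + 1) div 2 \<in> {1..<D}" if "odd k" "k < 2 * D" "k \<noteq> 2 * D - 1" for k
      using that by (auto elim!: oddE)
    have rp: "l ((k + 1) div 2) \<noteq> rp" if "odd k" "k < 2 * D" "k \<noteq> 2 * D - 1" for k
      using range[OF that] lr rho by auto
    show ?thesis
    proof (cases "i = 2 * D - 1 \<or> j = 2 * D - 1")
      case True
      then show ?thesis
        using eq(1) False parity ij rp[of i] rp[of j] by (auto simp: a_eigenvalue_def split: if_splits)
    next
      case neither: False
      then have "l ((i + 1) div 2) = l ((j + 1) div 2)"
        using eq(1) False parity by (simp add: a_eigenvalue_def)
      then have "(i + 1) div 2 = (j + 1) div 2"
        using inj_onD[OF l] range[of i] range[of j] False parity ij neither by auto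
      then show ?thesis using False parity by (auto elim!: oddE)
    qed
  qed
qed

section \<open>Multiplicity-freeness and irreducibility\<close>

theorem theorem3p5:
  fixes D :: nat and r0 r1 rho_m rho_p :: complex
    and c s lam mu :: "nat \<Rightarrow> complex"
  assumes "D \<ge> 1"
    and "r0 \<noteq> 0" and "r1 \<noteq> 0"
    and "rho_m \<in> {r0, inverse r0}" and "rho_p \<in> {r0, inverse r0}"
    and "\<forall>i\<in>{1..<D}. c i \<noteq> 0" and "\<forall>i\<in>{0..<D}. s i \<noteq> 0"
    and "\<forall>i\<in>{1..<D}. lam i \<noteq> 0" and "\<forall>i\<in>{0..<D}. mu i \<noteq> 0"
    and "inj_on lam {1..<D}"
    and "\<forall>i\<in>{1..<D}. lam i \<notin> {r0, inverse r0}"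
    and "inj_on mu {0..<D}"
  shows "(\<exists>E. is_E D r0 r1 rho_m rho_p c s lam mu E) \<and>
    (\<forall>E. is_E D r0 r1 rho_m rho_p c s lam mu E \<longrightarrow>
       H_multiplicity_free r0 r1 (2 * D) E \<and> H_irreducible r0 r1 (2 * D) E)"
proof (intro conjI allI impI)
  let ?M = "E_matrix D r0 r1 rho_m rho_p c s lam mu"
  let ?a = "a_eigenvalue D rho_p lam" and ?b = "b_eigenvalue mu"
  have carrier: "\<forall>g. ?M g \<in> carrier_mat (2 * D) (2 * D)"
    using E_matrix_carrier[OF assms(1)] by blast
  show "\<exists>E. is_E D r0 r1 rho_m rho_p c s lam mu E"
    unfolding is_E_def
    by (rule H_module_of_matrices[OF carrier E_relations[OF assms(1-8)]])
  have inj: "inj_on (\<lambda>i. (?a i, ?b i)) {..<2 * D}"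
    by (rule eigenvalue_pairs_inj) (use assms in auto)
  fix E assume "is_E D r0 r1 rho_m rho_p c s lam mu E"
  then have module: "H_module r0 r1 (2 * D) E" and gens: "\<And>g. E (H_gen r0 r1 g) = ?M g"
    by (auto simp: is_E_def)
  have A: "E (H_A r0 r1) = mat_diag (2 * D) ?a" and B: "E (H_B r0 r1) = mat_diag (2 * D) ?b"
    using H_module_H_A_H_B[OF module] E_U0_mult_T0[OF assms(1,6)] E_T1_mult_U1[OF assms(1,7)]
    by (simp_all add: gens)
  show "H_multiplicity_free r0 r1 (2 * D) E"
    by (rule H_multiplicity_free_of_diagonal[of E r0 r1 _ ?a ?b, OF A B inj])
  have "W = carrier_vec (2 * D)"
    if sub: "H_submodule r0 r1 (2 * D) E W" and ne: "W \<noteq> {0\<^sub>v (2 * D)}" for W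
  proof (rule invariant_subspace_trivial[of W "2 * D" "{?a, ?b}" "{?M T0, ?M T1}"])
    have act: "E x *\<^sub>v w \<in> W" if "x \<in> carrier (H_alg r0 r1)" "w \<in> W" for x w
      using sub that by (auto simp: H_submodule_def)
    show "VectorSpace.subspace class_ring W (module_vec TYPE(complex) (2 * D))"
      using sub by (simp add: H_submodule_def)
    show "mat_diag (2 * D) f *\<^sub>v w \<in> W" if "f \<in> {?a, ?b}" "w \<in> W" for f w
      using that act[of "H_A r0 r1" w] act[of "H_B r0 r1" w]
      by (auto simp: A B H_A_def H_B_def H_gen_def H_class_mult carrier_H_alg simp flip: A B)
    show "T *\<^sub>v w \<in> W" if "T \<in> {?M T0, ?M T1}" "w \<in> W" for T w
      using that act[of "H_gen r0 r1 _" w] by (auto simp: carrier_H_alg H_gen_def simp flip: gens)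
    show "\<exists>f\<in>{?a, ?b}. f j \<noteq> f i" if "i < 2 * D" "j < 2 * D" "j \<noteq> i" for i j
      using inj_onD[OF inj, of j i] that by auto
    show "\<exists>T\<in>{?M T0, ?M T1}. T $$ (i, Suc i) \<noteq> 0 \<and> T $$ (Suc i, i) \<noteq> 0"
      if "Suc i < 2 * D" for i
      by (rule E_links[OF assms(2,6,7,8,11) that])
  qed (use carrier ne in auto)
  then show "H_irreducible r0 r1 (2 * D) E"
    unfolding H_irreducible_def by blast
qed

end
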